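(* For $x\in\mathbb C\setminus\{0,1\}$ let $\mu_1(x)=\frac{(x+1)-i(1-x)}{\sqrt{2x}}$ and $\mu_2(x)=\frac{(x+1)+i(1-x)}{\sqrt{2x}}$ be the two distinct eigenvalues of $\hat R(x)$, and set $$\Pi^{(1)}=\frac{\hat R(x)-\mu_2(x)}{\mu_1(x)-\mu_2(x)},\qquad \Pi^{(2)}=\frac{\hat R(x)-\mu_1(x)}{\mu_2(x)-\mu_1(x)} .$$ Then $\Pi^{(1)},\Pi^{(2)}$ are independent of $x$, satisfy $(\Pi^{(i)})^2=\Pi^{(i)}$ and $\Pi^{(1)}+\Pi^{(2)}=1$, are the projectors on the eigenspaces of $\hat R(x)$, and commute with the tensor square of the fundamental representation $\pi$: $$\Big[\Pi^{(a)},\ \sum_{k=1}^2\pi(L^{\pm}_{ik})\otimes\pi(L^{\pm}_{kj})\Big]=0\qquad\text{for all } a,i,j\in\{1,2\}\text{ and both signs}.$$ In particular, the eigenspaces of $\hat R$ are invariant under the tensor product $(\pi\otimes\pi)\circ\delta$.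
   Context: Let $P$ be the flip matrix on $\mathbb C^2\otimes\mathbb C^2$, with basis ordered $e_1\otimes e_1, e_1\otimes e_2, e_2\otimes e_1, e_2\otimes e_2$. Let $$R=\frac1{\sqrt2}\begin{pmatrix}1&0&0&1\\0&1&1&0\\0&1&-1&0\\-1&0&0&1\end{pmatrix},\qquad \hat R=PR,\qquad \hat R(x)=x^{-1/2}\hat R+x^{1/2}\hat R^{-1},$$ where for each $x$ a square root of $x$ is fixed (used consistently also in $\sqrt{2x}=\sqrt2\,x^{1/2}$). The algebra $s03_F$ is generated by $L^\pm_{ij}$ ($i,j=1,2$) subject to $R^{+}L^{+}_1L^{+}_2=L^{+}_2L^{+}_1R^{+}$, $R^{+}L^{-}_1L^{-}_2=L^{-}_2L^{-}_1R^{+}$, $R^{+}L^{+}_1L^{-}_2=L^{-}_2L^{+}_1R^{+}$, with $R^+=PRP$, $L_1=L\otimes\mathbf 1$, $L_2=\mathbf 1\otimes L$, and has coproduct $\delta(L^\pm_{ij})=\sum_k L^\pm_{ik}\otimes L^\pm_{kj}$. The fundamental representation $\pi$ on $\mathbb C^2$ is given by $(\pi(L^+_{ij}))_{m}^{p}=(PRP)_{(i,m),(j,p)}$ and $(\pi(L^-_{ij}))_m^p=(R^{-1})_{(i,m),(j,p)}$ (row index $m$, column index $p$). Explicitly, up to the common factor $1/\sqrt2$: $$L^\pm_{11}\mapsto\begin{pmatrix}1&0\\0&\mp1\end{pmatrix},\quad L^\pm_{12}\mapsto\begin{pmatrix}0&\pm1\\1&0\end{pmatrix},\quad L^\pm_{21}\mapsto\begin{pmatrix}0&1\\\mp1&0\end{pmatrix},\quad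 L^\pm_{22}\mapsto\begin{pmatrix}\pm1&0\\0&1\end{pmatrix}.$$ *)

theory Defs
  imports "HOL-Analysis.Analysis" "HOL-Library.Poly_Mapping"
begin

hide_const (open) Poly_Mapping.range

section \<open>Complex matrices\<close>

definition mat_scale :: "complex \<Rightarrow> complex^'n^'m \<Rightarrow> complex^'n^'m" (infixr \<open>*\<^sub>M\<close> 75)
  where "c *\<^sub>M A = map_matrix ((*) c) A"

text \<open>The space \<open>V \<otimes> W\<close> of column vectors has its coordinates indexed by pairs;
  \<open>(i, m)\<close> stands for \<open>e\<^sub>i \<otimes> e\<^sub>m\<close>.\<close>

definition kron :: "'a::times^'n^'m \<Rightarrow> 'a^'q^'p \<Rightarrow> 'a^('n \<times> 'q)^('m \<times> 'p)"
  where "kron A B = (\<chi> r c. A $ fst r $ fst c * B $ snd r $ snd c)"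

definition commutator :: "complex^'n^'n \<Rightarrow> complex^'n^'n \<Rightarrow> complex^'n^'n"
  where "commutator A B = A ** B - B ** A"

definition eigenspace :: "complex^'n^'n \<Rightarrow> complex \<Rightarrow> (complex^'n) set"
  where "eigenspace A c = {v. A *v v = c *s v}"

definition is_eigenvalue :: "complex^'n^'n \<Rightarrow> complex \<Rightarrow> bool"
  where "is_eigenvalue A c \<longleftrightarrow> (\<exists>v. v \<noteq> 0 \<and> A *v v = c *s v)"


section \<open>The R-matrix\<close>

type_synonym mat2 = "complex^2^2"
type_synonym mat4 = "complex^(2 \<times> 2)^(2 \<times> 2)"

text \<open>Position of \<open>e\<^sub>i \<otimes> e\<^sub>m\<close> in the ordered basis
  \<open>e\<^sub>1 \<otimes> e\<^sub>1, e\<^sub>1 \<otimes> e\<^sub>2, e\<^sub>2 \<otimes> e\<^sub>1, e\<^sub>2 \<otimes> e\<^sub>2\<close>, counting from 0.\<close>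

definition pos :: "2 \<times> 2 \<Rightarrow> nat"
  where "pos r = (if fst r = 1 then 0 else 2) + (if snd r = 1 then 0 else 1)"

definition flip :: mat4
  where "flip = (\<chi> r c. if c = prod.swap r then 1 else 0)"

definition Rmat :: mat4
  where "Rmat = (1 / complex_of_real (sqrt 2)) *\<^sub>M
    (\<chi> r c. [[ 1, 0,  0, 1],
             [ 0, 1,  1, 0],
             [ 0, 1, -1, 0],
             [-1, 0,  0, 1]] ! pos r ! pos c)"

definition Rplus :: mat4
  where "Rplus = flip ** Rmat ** flip"

definition Rhat :: mat4
  where "Rhat = flip ** Rmat"

text \<open>In the following definitions \<open>rt\<close> is the chosen square root function, \<open>(rt x)\<^sup>2 = x\<close>.\<close>

definition Rhat_x :: "(complex \<Rightarrow> complex) \<Rightarrow> complex \<Rightarrow> mat4"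
  where "Rhat_x rt x = inverse (rt x) *\<^sub>M Rhat + rt x *\<^sub>M matrix_inv Rhat"

definition mu1 :: "(complex \<Rightarrow> complex) \<Rightarrow> complex \<Rightarrow> complex"
  where "mu1 rt x = ((x + 1) - \<i> * (1 - x)) / (complex_of_real (sqrt 2) * rt x)"

definition mu2 :: "(complex \<Rightarrow> complex) \<Rightarrow> complex \<Rightarrow> complex"
  where "mu2 rt x = ((x + 1) + \<i> * (1 - x)) / (complex_of_real (sqrt 2) * rt x)"

definition Pi1 :: "(complex \<Rightarrow> complex) \<Rightarrow> complex \<Rightarrow> mat4"
  where "Pi1 rt x = (1 / (mu1 rt x - mu2 rt x)) *\<^sub>M (Rhat_x rt x - mat (mu2 rt x))"

definition Pi2 :: "(complex \<Rightarrow> complex) \<Rightarrow> complex \<Rightarrow> mat4"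
  where "Pi2 rt x = (1 / (mu2 rt x - mu1 rt x)) *\<^sub>M (Rhat_x rt x - mat (mu1 rt x))"


section \<open>Free algebras\<close>

datatype 'g word = Word (letters: "'g list")

instantiation word :: (type) monoid_add
begin
definition "0 = Word []"
definition "u + v = Word (letters u @ letters v)"
instance by standard (simp_all add: zero_word_def plus_word_def)
end

text \<open>The free complex algebra on \<open>'g\<close> is the monoid algebra of \<open>'g word\<close>, and the tensor square
  of that algebra is the monoid algebra of \<open>'g word \<times> 'g word\<close>, where
  \<open>u \<otimes> v\<close> is the basis element at \<open>(u, v)\<close>.\<close>

type_synonym 'g free_alg = "'g word \<Rightarrow>\<^sub>0 complex"
type_synonym 'g free_alg2 = "('g word \<times> 'g word) \<Rightarrow>\<^sub>0 complex"

abbreviation const :: "complex \<Rightarrow> ('m::monoid_add \<Rightarrow>\<^sub>0 complex)"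
  where "const \<equiv> Poly_Mapping.single 0"

definition gen :: "'g \<Rightarrow> 'g free_alg"
  where "gen g = Poly_Mapping.single (Word [g]) 1"

text \<open>Linear extension of a map on the monoid basis.\<close>

definition extend_mat :: "('m \<Rightarrow> complex^'n^'n) \<Rightarrow> ('m \<Rightarrow>\<^sub>0 complex) \<Rightarrow> complex^'n^'n"
  where "extend_mat f p = (\<Sum>w\<in>Poly_Mapping.keys p. Poly_Mapping.lookup p w *\<^sub>M f w)"

definition extend_alg :: "('m \<Rightarrow> ('k::monoid_add \<Rightarrow>\<^sub>0 complex)) \<Rightarrow> ('m \<Rightarrow>\<^sub>0 complex) \<Rightarrow> ('k \<Rightarrow>\<^sub>0 complex)"
  where "extend_alg f p = (\<Sum>w\<in>Poly_Mapping.keys p. const (Poly_Mapping.lookup p w) * f w)"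

definition free_tensor :: "'g free_alg \<Rightarrow> 'g free_alg \<Rightarrow> 'g free_alg2"
  where "free_tensor p q =
    extend_alg (\<lambda>u. extend_alg (\<lambda>v. Poly_Mapping.single (u, v) 1) q) p"

definition word_mat :: "('g \<Rightarrow> complex^'n^'n) \<Rightarrow> 'g word \<Rightarrow> complex^'n^'n"
  where "word_mat \<rho> w = foldr (\<lambda>g A. \<rho> g ** A) (letters w) (mat 1)"

definition word_alg :: "('g \<Rightarrow> ('k::monoid_add \<Rightarrow>\<^sub>0 complex)) \<Rightarrow> 'g word \<Rightarrow> ('k \<Rightarrow>\<^sub>0 complex)"
  where "word_alg f w = foldr (\<lambda>g a. f g * a) (letters w) 1"

inductive_set ideal_gen :: "'a::ring_1 set \<Rightarrow> 'a set" for S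
  where
    ideal_gen_zero: "0 \<in> ideal_gen S"
  | ideal_gen_base: "s \<in> S \<Longrightarrow> a * s * b \<in> ideal_gen S"
  | ideal_gen_add: "x \<in> ideal_gen S \<Longrightarrow> y \<in> ideal_gen S \<Longrightarrow> x + y \<in> ideal_gen S"


section \<open>The defining data of the algebra\<close>

datatype pm = Plus | Minus

datatype s03_gen = Lgen pm 2 2

definition Lmat :: "pm \<Rightarrow> s03_gen free_alg^2^2"
  where "Lmat s = (\<chi> i j. gen (Lgen s i j))"

definition s03_relators :: "s03_gen free_alg set"
  where "s03_relators =
    {(map_matrix const Rplus ** kron (Lmat s) (mat 1) ** kron (mat 1) (Lmat t)
       - kron (mat 1) (Lmat t) ** kron (Lmat s) (mat 1) ** map_matrix const Rplus) $ r $ c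
     | s t r c. (s, t) \<in> {(Plus, Plus), (Minus, Minus), (Plus, Minus)}}"

definition s03_ideal :: "s03_gen free_alg set"
  where "s03_ideal = ideal_gen s03_relators"

text \<open>The kernel \<open>I \<otimes> F + F \<otimes> I\<close> of the map from the tensor square of the free algebra \<open>F\<close>
  to the tensor square of \<open>F / I\<close>.\<close>

definition s03_ideal2 :: "s03_gen free_alg2 set"
  where "s03_ideal2 =
    ideal_gen ((\<lambda>p. free_tensor p 1) ` s03_relators \<union> (\<lambda>p. free_tensor 1 p) ` s03_relators)"

definition coproduct_gen :: "s03_gen \<Rightarrow> s03_gen free_alg2"
  where "coproduct_gen g =
    (case g of Lgen s i j \<Rightarrow> \<Sum>k\<in>UNIV. free_tensor (gen (Lgen s i k)) (gen (Lgen s k j)))"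

definition coproduct_free :: "s03_gen free_alg \<Rightarrow> s03_gen free_alg2"
  where "coproduct_free = extend_alg (word_alg coproduct_gen)"

definition pi_gen :: "s03_gen \<Rightarrow> mat2"
  where "pi_gen g = (case g of
      Lgen Plus i j \<Rightarrow> (\<chi> m p. Rplus $ (i, m) $ (j, p))
    | Lgen Minus i j \<Rightarrow> (\<chi> m p. matrix_inv Rmat $ (i, m) $ (j, p)))"

definition pi_free :: "s03_gen free_alg \<Rightarrow> mat2"
  where "pi_free = extend_mat (word_mat pi_gen)"

definition pi2_free :: "s03_gen free_alg2 \<Rightarrow> mat4"
  where "pi2_free = extend_mat (\<lambda>(u, v). kron (word_mat pi_gen u) (word_mat pi_gen v))"


section \<open>Well-definedness modulo the relations\<close>

lemma pm_induct [case_names single add]: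
  fixes p :: "'m \<Rightarrow>\<^sub>0 'c::comm_monoid_add"
  assumes s: "\<And>w c. P (Poly_Mapping.single w c)"
    and a: "\<And>p q. P p \<Longrightarrow> P q \<Longrightarrow> P (p + q)"
  shows "P p"
proof (induction p rule: update_induct)
  case const
  show ?case using s[of undefined 0] by simp
next
  case (update f a b)
  have "Poly_Mapping.update a b f = f + Poly_Mapping.single a b"
    using update.hyps
    by (intro poly_mapping_eqI) (auto simp: lookup_update lookup_add lookup_single in_keys_iff when_def)
  then show ?case using a[OF update.IH s] by simp
qed

lemma mat_scale_nth [simp]: "(c *\<^sub>M A) $ i $ j = c * A $ i $ j"
  by (simp add: mat_scale_def)

lemma mat_scale_simps [simp]:
  "0 *\<^sub>M A = 0" "1 *\<^sub>M A = A" "c *\<^sub>M (0::complex^'n^'m) = 0"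
  by (simp_all add: vec_eq_iff)

lemma mat_scale_add_left: "(c + d) *\<^sub>M A = c *\<^sub>M A + d *\<^sub>M A"
  by (simp add: vec_eq_iff algebra_simps)

lemma mat_mul_add_right: "((A::complex^'n^'m) + B) ** (C::complex^'p^'n) = A ** C + B ** C"
  by (simp add: vec_eq_iff matrix_matrix_mult_def algebra_simps sum.distrib)

lemma mat_scale_mul: "(c *\<^sub>M A) ** (d *\<^sub>M B) = (c * d) *\<^sub>M (A ** B)"
  by (simp add: vec_eq_iff matrix_matrix_mult_def sum_distrib_left mult_ac)

lemma extend_mat_add: "extend_mat f (p + q) = extend_mat f p + extend_mat f q"
  unfolding extend_mat_def
  by (rule setsum_keys_plus_distrib[where f = "\<lambda>w c. c *\<^sub>M f w"]) (simp_all add: mat_scale_add_left)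

lemma extend_mat_single [simp]: "extend_mat f (Poly_Mapping.single w c) = c *\<^sub>M f w"
  by (simp add: extend_mat_def)

lemma extend_mat_zero [simp]: "extend_mat f 0 = 0"
  by (simp add: extend_mat_def)

lemma extend_mat_minus: "extend_mat f (p - q) = extend_mat f p - extend_mat f q"
  by (metis extend_mat_add add_diff_cancel_right' diff_add_cancel)

lemma extend_mat_sum: "extend_mat f (sum g A) = (\<Sum>x\<in>A. extend_mat f (g x))"
  by (induction A rule: infinite_finite_induct) (auto simp: extend_mat_add)

lemma extend_mat_mult:
  assumes "\<And>u v. f (u + v) = f u ** f v"
  shows "extend_mat f (p * q) = extend_mat f p ** extend_mat f q"
proof (induction p rule: pm_induct)
  case (single w c)
  show ?case
    by (induction q rule: pm_induct)
      (simp_all add: mult_single assms mat_scale_mul distrib_left extend_mat_add matrix_add_ldistrib)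
qed (simp add: distrib_right extend_mat_add mat_mul_add_right)

lemma extend_alg_add: "extend_alg f (p + q) = extend_alg f p + extend_alg f q"
  unfolding extend_alg_def
  by (rule setsum_keys_plus_distrib[where f = "\<lambda>w c. const c * f w"])
    (simp_all add: single_add distrib_right)

lemma extend_alg_single [simp]: "extend_alg f (Poly_Mapping.single w c) = const c * f w"
  by (simp add: extend_alg_def)

lemma extend_alg_zero [simp]: "extend_alg f 0 = 0"
  by (simp add: extend_alg_def)

lemma extend_alg_minus: "extend_alg f (p - q) = extend_alg f p - extend_alg f q"
  by (metis extend_alg_add add_diff_cancel_right' diff_add_cancel)

lemma extend_alg_sum: "extend_alg f (sum g A) = (\<Sum>x\<in>A. extend_alg f (g x))"
  by (induction A rule: infinite_finite_induct) (auto simp: extend_alg_add)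

lemma const_central: "const c * p = p * const c"
  by (induction p rule: pm_induct) (simp_all add: mult_single distrib_left distrib_right mult.commute)

lemma extend_alg_mult:
  assumes "\<And>u v. f (u + v) = f u * f v"
  shows "extend_alg f (p * q) = extend_alg f p * extend_alg f q"
proof (induction p rule: pm_induct)
  case (single w c)
  show ?case
  proof (induction q rule: pm_induct)
    case (single v d)
    have "const c * const d * f w = const c * f w * const d"
      by (metis const_central mult.assoc)
    then show ?case
      by (simp add: mult_single assms flip: mult.assoc)
  qed (simp add: distrib_left extend_alg_add)
qed (simp add: distrib_right extend_alg_add)

lemma word_mat_add: "word_mat \<rho> (u + v) = word_mat \<rho> u ** word_mat \<rho> v"
proof -
  have "foldr (\<lambda>g A. \<rho> g ** A) xs B = foldr (\<lambda>g A. \<rho> g ** A) xs (mat 1) ** B" for xs B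
    by (induction xs) (auto simp: matrix_mul_assoc)
  from this[of "letters u" "foldr (\<lambda>g A. \<rho> g ** A) (letters v) (mat 1)"]
  show ?thesis by (simp add: word_mat_def plus_word_def)
qed

lemma word_mat_zero [simp]: "word_mat \<rho> 0 = mat 1"
  by (simp add: word_mat_def zero_word_def)

lemma word_mat_letter [simp]: "word_mat \<rho> (Word [g]) = \<rho> g"
  by (simp add: word_mat_def)

lemma word_alg_add: "word_alg f (u + v) = word_alg f u * word_alg f v"
proof -
  have "foldr (\<lambda>g a. f g * a) xs b = foldr (\<lambda>g a. f g * a) xs 1 * b" for xs b
    by (induction xs) (auto simp: mult.assoc)
  from this[of "letters u" "foldr (\<lambda>g a. f g * a) (letters v) 1"]
  show ?thesis by (simp add: word_alg_def plus_word_def)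
qed

lemma word_alg_zero [simp]: "word_alg f 0 = 1"
  by (simp add: word_alg_def zero_word_def)

lemma word_alg_letter [simp]: "word_alg f (Word [g]) = f g"
  by (simp add: word_alg_def)

lemma kron_mult:
  fixes A :: "'a::comm_semiring_1^'n^'m"
  shows "kron (A ** B) (C ** D) = kron A C ** kron B D"
proof -
  have "(\<Sum>k\<in>UNIV. A $ i $ k * B $ k $ j) * (\<Sum>l\<in>UNIV. C $ m $ l * D $ l $ p)
      = (\<Sum>x\<in>UNIV. (A $ i $ fst x * C $ m $ snd x) * (B $ fst x $ j * D $ snd x $ p))" for i j m p
  proof -
    have "(\<Sum>k\<in>UNIV. A $ i $ k * B $ k $ j) * (\<Sum>l\<in>UNIV. C $ m $ l * D $ l $ p)
        = (\<Sum>(k, l)\<in>UNIV \<times> UNIV. (A $ i $ k * B $ k $ j) * (C $ m $ l * D $ l $ p))"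
      by (subst sum_product) (subst sum.cartesian_product, rule refl)
    also have "\<dots> = (\<Sum>x\<in>UNIV. (A $ i $ fst x * C $ m $ snd x) * (B $ fst x $ j * D $ snd x $ p))"
      by (rule sum.cong) (auto simp: mult_ac)
    finally show ?thesis .
  qed
  then show ?thesis
    unfolding kron_def matrix_matrix_mult_def by (simp only: vec_lambda_beta)
qed

lemma kron_mat_1 [simp]: "kron (mat 1 :: 'a::semiring_1^'n^'n) (mat 1 :: 'a^'m^'m) = mat 1"
  by (auto simp: vec_eq_iff kron_def mat_def prod_eq_iff)

lemma pi_free_mult: "pi_free (p * q) = pi_free p ** pi_free q"
  unfolding pi_free_def by (rule extend_mat_mult) (rule word_mat_add)

lemma pi2_free_mult: "pi2_free (p * q) = pi2_free p ** pi2_free q"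
  unfolding pi2_free_def by (rule extend_mat_mult) (simp add: split_beta word_mat_add kron_mult)

lemma coproduct_free_mult: "coproduct_free (p * q) = coproduct_free p * coproduct_free q"
  unfolding coproduct_free_def by (rule extend_alg_mult) (rule word_alg_add)

lemma free_tensor_single:
  "free_tensor (Poly_Mapping.single u c) (Poly_Mapping.single v d) = Poly_Mapping.single (u, v) (c * d)"
  by (simp add: free_tensor_def mult_single zero_prod_def[symmetric])

lemma free_tensor_add_left: "free_tensor (p + p') q = free_tensor p q + free_tensor p' q"
  by (simp add: free_tensor_def extend_alg_add)

lemma free_tensor_add_right: "free_tensor p (q + q') = free_tensor p q + free_tensor p q'"
  by (induction p rule: pm_induct)
    (simp_all add: free_tensor_add_left, simp add: free_tensor_def extend_alg_add distrib_left)

lemma free_tensor_zero [simp]: "free_tensor 0 q = 0" "free_tensor p 0 = 0"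
  using free_tensor_add_left[of 0 0 q] free_tensor_add_right[of p 0 0] by simp_all

lemma free_tensor_diff_left: "free_tensor (p - p') q = free_tensor p q - free_tensor p' q"
  by (metis free_tensor_add_left add_diff_cancel_right' diff_add_cancel)

lemma free_tensor_diff_right: "free_tensor p (q - q') = free_tensor p q - free_tensor p q'"
  by (metis free_tensor_add_right add_diff_cancel_right' diff_add_cancel)

lemma free_tensor_sum_left: "free_tensor (sum f A) q = (\<Sum>x\<in>A. free_tensor (f x) q)"
  by (induction A rule: infinite_finite_induct) (auto simp: free_tensor_add_left)

lemma free_tensor_sum_right: "free_tensor p (sum f A) = (\<Sum>x\<in>A. free_tensor p (f x))"
  by (induction A rule: infinite_finite_induct) (auto simp: free_tensor_add_right)

lemma free_tensor_mult: "free_tensor p q * free_tensor p' q' = free_tensor (p * p') (q * q')"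
proof (induction p rule: pm_induct)
  case (single w c)
  show ?case
  proof (induction q rule: pm_induct)
    case (single w2 c2)
    show ?case
    proof (induction p' rule: pm_induct)
      case (single w3 c3)
      show ?case
        by (induction q' rule: pm_induct)
          (simp_all add: free_tensor_single mult_single mult_ac distrib_left free_tensor_add_right)
    qed (simp add: distrib_left free_tensor_add_left)
  qed (simp add: distrib_right free_tensor_add_right)
qed (simp add: distrib_right free_tensor_add_left)

lemma free_tensor_one: "free_tensor 1 1 = 1"
  using free_tensor_single[of 0 1 0 1] by (simp add: zero_prod_def[symmetric])

lemma free_tensor_const:
  fixes p q :: "'g free_alg"
  shows
  "free_tensor (const c * p) q = const c * free_tensor p q"
  "free_tensor p (const c * q) = const c * free_tensor p q"
proof -
  have "const c = free_tensor (const c) (1 :: 'g free_alg)"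
    "const c = free_tensor (1 :: 'g free_alg) (const c)"
    using free_tensor_single[of "0 :: 'g word" c "0 :: 'g word" 1]
      free_tensor_single[of "0 :: 'g word" 1 "0 :: 'g word" c]
    by (simp_all add: zero_prod_def[symmetric])
  then show "free_tensor (const c * p) q = const c * free_tensor p q"
    "free_tensor p (const c * q) = const c * free_tensor p q"
    by (metis free_tensor_mult mult_1)+
qed

lemma pi2_free_tensor: "pi2_free (free_tensor p q) = kron (pi_free p) (pi_free q)"
proof (induction p rule: pm_induct)
  case (single w c)
  show ?case
  proof (induction q rule: pm_induct)
    case (single v d)
    show ?case
      by (simp add: free_tensor_single pi2_free_def pi_free_def vec_eq_iff kron_def)
  next
    case (add p q)
    have "pi2_free (a + b) = pi2_free a + pi2_free b" "pi_free (a' + b') = pi_free a' + pi_free b'"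
      for a b a' b' by (simp_all add: pi2_free_def pi_free_def extend_mat_add)
    then show ?case using add
      by (simp add: free_tensor_add_right vec_eq_iff kron_def distrib_left)
  qed
next
  case (add p q)
  have "pi2_free (a + b) = pi2_free a + pi2_free b" "pi_free (a' + b') = pi_free a' + pi_free b'"
    for a b a' b' by (simp_all add: pi2_free_def pi_free_def extend_mat_add)
  then show ?case using add
    by (simp add: free_tensor_add_left vec_eq_iff kron_def distrib_right)
qed

lemma ideal_gen_mult:
  assumes "x \<in> ideal_gen S"
  shows "a * x * b \<in> ideal_gen S"
  using assms
proof induction
  case (ideal_gen_base s a' b')
  have "a * (a' * s * b') * b = (a * a') * s * (b' * b)" by (simp add: mult.assoc)
  then show ?case using ideal_gen.ideal_gen_base[OF ideal_gen_base] by metis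
qed (auto simp: distrib_left distrib_right intro: ideal_gen.intros)

lemma ideal_gen_simple: "s \<in> S \<Longrightarrow> s \<in> ideal_gen S"
  using ideal_gen_base[of s S 1 1] by simp

lemma ideal_gen_uminus: "x \<in> ideal_gen S \<Longrightarrow> - x \<in> ideal_gen S"
  using ideal_gen_mult[of x S "-1" 1] by simp

lemma ideal_gen_diff: "x \<in> ideal_gen S \<Longrightarrow> y \<in> ideal_gen S \<Longrightarrow> x - y \<in> ideal_gen S"
  using ideal_gen_add[OF _ ideal_gen_uminus] by fastforce

lemma ideal_gen_sum: "(\<And>x. x \<in> A \<Longrightarrow> f x \<in> ideal_gen S) \<Longrightarrow> sum f A \<in> ideal_gen S"
  by (induction A rule: infinite_finite_induct) (auto intro: ideal_gen.intros)

lemma ideal_gen_equivp: "equivp (\<lambda>x y. x - y \<in> ideal_gen S)"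
proof (rule equivpI)
  show "reflp (\<lambda>x y. x - y \<in> ideal_gen S)" by (rule reflpI) (simp add: ideal_gen_zero)
  show "symp (\<lambda>x y. x - y \<in> ideal_gen S)"
    by (rule sympI) (metis ideal_gen_uminus minus_diff_eq)
  show "transp (\<lambda>x y. x - y \<in> ideal_gen S)"
    by (rule transpI) (metis ideal_gen_add diff_add_eq add.commute diff_add_cancel add_diff_eq)
qed

lemma ideal_gen_cong_add:
  "x - x' \<in> ideal_gen S \<Longrightarrow> y - y' \<in> ideal_gen S \<Longrightarrow> (x + y) - (x' + y') \<in> ideal_gen S"
  using ideal_gen_add[of "x - x'" S "y - y'"] by (simp add: algebra_simps)

lemma ideal_gen_cong_diff:
  "x - x' \<in> ideal_gen S \<Longrightarrow> y - y' \<in> ideal_gen S \<Longrightarrow> (x - y) - (x' - y') \<in> ideal_gen S"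
  using ideal_gen_diff[of "x - x'" S "y - y'"] by (simp add: algebra_simps)

lemma ideal_gen_cong_uminus:
  "x - x' \<in> ideal_gen S \<Longrightarrow> (- x) - (- x') \<in> ideal_gen S"
  using ideal_gen_uminus[of "x - x'" S] by (simp add: algebra_simps)

lemma ideal_gen_cong_mult:
  assumes "x - x' \<in> ideal_gen S" "y - y' \<in> ideal_gen S"
  shows "x * y - x' * y' \<in> ideal_gen S"
proof -
  have "1 * (x - x') * y + x' * (y - y') * 1 \<in> ideal_gen S"
    by (intro ideal_gen_add ideal_gen_mult assms)
  then show ?thesis by (simp add: algebra_simps)
qed

lemma sum_pairs: "(\<Sum>c\<in>(UNIV :: (2 \<times> 2) set). f c) = f (1, 1) + f (1, 2) + f (2, 1) + f (2, 2)"
proof -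
  have "(\<Sum>c\<in>(UNIV :: (2 \<times> 2) set). f c) = (\<Sum>i\<in>UNIV. \<Sum>m\<in>UNIV. f (i, m))"
    by (simp add: sum.cartesian_product UNIV_Times_UNIV[symmetric] del: UNIV_Times_UNIV)
  then show ?thesis by (simp add: sum_2 add.assoc)
qed

lemma forall_pairs: "(\<forall>r::2 \<times> 2. P r) \<longleftrightarrow> P (1, 1) \<and> P (1, 2) \<and> P (2, 1) \<and> P (2, 2)"
  by (auto simp: forall_2 split_paired_All)

definition Lprod :: "pm \<Rightarrow> pm \<Rightarrow> 2 \<times> 2 \<Rightarrow> 2 \<times> 2 \<Rightarrow> s03_gen free_alg"
  where "Lprod s t r c = gen (Lgen s (fst r) (fst c)) * gen (Lgen t (snd r) (snd c))"

definition Lprod_rev :: "pm \<Rightarrow> pm \<Rightarrow> 2 \<times> 2 \<Rightarrow> 2 \<times> 2 \<Rightarrow> s03_gen free_alg"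
  where "Lprod_rev s t r c = gen (Lgen t (snd r) (snd c)) * gen (Lgen s (fst r) (fst c))"

definition relator :: "pm \<Rightarrow> pm \<Rightarrow> 2 \<times> 2 \<Rightarrow> 2 \<times> 2 \<Rightarrow> s03_gen free_alg"
  where "relator s t r c =
    (\<Sum>d\<in>UNIV. const (Rplus $ r $ d) * Lprod s t d c) -
    (\<Sum>d\<in>UNIV. const (Rplus $ d $ c) * Lprod_rev s t r d)"

lemma kron_L1_L2:
  "kron (Lmat s) (mat 1) ** kron (mat 1) (Lmat t) = (\<chi> r c. Lprod s t r c)"
  "kron (mat 1) (Lmat t) ** kron (Lmat s) (mat 1) = (\<chi> r c. Lprod_rev s t r c)"
  unfolding vec_eq_iff forall_pairs matrix_matrix_mult_def sum_pairs
  by (simp_all add: kron_def mat_def Lmat_def Lprod_def Lprod_rev_def)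

lemma s03_relators_alt:
  "s03_relators = {relator s t r c | s t r c. (s, t) \<in> {(Plus, Plus), (Minus, Minus), (Plus, Minus)}}"
proof -
  have "(map_matrix const Rplus ** kron (Lmat s) (mat 1) ** kron (mat 1) (Lmat t)
       - kron (mat 1) (Lmat t) ** kron (Lmat s) (mat 1) ** map_matrix const Rplus) $ r $ c
     = relator s t r c" for s t r c
  proof -
    have "map_matrix const Rplus ** kron (Lmat s) (mat 1) ** kron (mat 1) (Lmat t)
        = map_matrix const Rplus ** (\<chi> r c. Lprod s t r c)"
      by (simp only: matrix_mul_assoc[symmetric] kron_L1_L2)
    moreover have "(\<chi> r c. Lprod_rev s t r c) ** map_matrix const Rplus
        = (\<chi> r c. \<Sum>d\<in>UNIV. const (Rplus $ d $ c) * Lprod_rev s t r d)"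
      by (simp add: matrix_matrix_mult_def vec_eq_iff const_central)
    ultimately show ?thesis
      unfolding kron_L1_L2 by (simp add: matrix_matrix_mult_def relator_def)
  qed
  then show ?thesis by (simp add: s03_relators_def)
qed

lemma matrix_inv_unique:
  fixes A B :: "complex^'n^'n"
  assumes "A ** B = mat 1" "B ** A = mat 1"
  shows "matrix_inv A = B"
proof -
  have "A ** matrix_inv A = mat 1 \<and> matrix_inv A ** A = mat 1"
    unfolding matrix_inv_def by (rule someI[of _ B]) (use assms in blast)
  then show ?thesis
    by (metis assms(2) matrix_mul_assoc matrix_mul_lid matrix_mul_rid)
qed

lemma pos_simps [simp]: "pos (1, 1) = 0" "pos (1, 2) = 1" "pos (2, 1) = 2" "pos (2, 2) = 3"
  by (simp_all add: pos_def)

lemma Rplus_explicit: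
  "Rplus = (1 / complex_of_real (sqrt 2)) *\<^sub>M
    (\<chi> r c. [[1, 0, 0, 1], [0, -1, 1, 0], [0, 1, 1, 0], [-1, 0, 0, 1]] ! pos r ! pos c)"
  unfolding Rplus_def vec_eq_iff forall_pairs matrix_matrix_mult_def sum_pairs Rmat_def flip_def
  by (simp add: numeral_2_eq_2 numeral_3_eq_3)

lemma sqrt2_sq: "complex_of_real (sqrt 2) * complex_of_real (sqrt 2) = 2"
  by (metis of_real_mult of_real_numeral real_sqrt_mult_self abs_numeral)

lemma Rmat_inv_explicit:
  "matrix_inv Rmat = (1 / complex_of_real (sqrt 2)) *\<^sub>M
    (\<chi> r c. [[1, 0, 0, -1], [0, 1, 1, 0], [0, 1, -1, 0], [1, 0, 0, 1]] ! pos r ! pos c)"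
  by (rule matrix_inv_unique;
      unfold vec_eq_iff forall_pairs matrix_matrix_mult_def sum_pairs Rmat_def mat_def;
      simp add: numeral_2_eq_2 numeral_3_eq_3 sqrt2_sq)

lemma pi_free_gen: "pi_free (gen g) = pi_gen g"
  by (simp add: pi_free_def gen_def)

lemma pi_free_const: "pi_free (const c) = mat c"
  by (simp add: pi_free_def vec_eq_iff mat_def)

lemma pi_free_add: "pi_free (p + q) = pi_free p + pi_free q"
  by (simp add: pi_free_def extend_mat_add)

lemma pi_free_minus: "pi_free (p - q) = pi_free p - pi_free q"
  by (simp add: pi_free_def extend_mat_minus)

lemma pi_gen_explicit:
  "pi_gen (Lgen Plus i j) = (1 / complex_of_real (sqrt 2)) *\<^sub>M
    (\<chi> m p. [[1, 0, 0, 1], [0, -1, 1, 0], [0, 1, 1, 0], [-1, 0, 0, 1]] ! pos (i, m) ! pos (j, p))"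
  "pi_gen (Lgen Minus i j) = (1 / complex_of_real (sqrt 2)) *\<^sub>M
    (\<chi> m p. [[1, 0, 0, -1], [0, 1, 1, 0], [0, 1, -1, 0], [1, 0, 0, 1]] ! pos (i, m) ! pos (j, p))"
  by (simp_all add: pi_gen_def Rplus_explicit Rmat_inv_explicit vec_eq_iff)

lemma mat_mult_left: "(mat c :: complex^'n^'n) ** A = c *\<^sub>M A"
  by (simp add: vec_eq_iff matrix_matrix_mult_def mat_def if_distrib[of "\<lambda>x. x * _"] cong: if_cong)

lemma pi_free_relator:
  assumes "(s, t) \<in> {(Plus, Plus), (Minus, Minus), (Plus, Minus)}"
  shows "pi_free (relator s t r c) = 0"
proof -
  have "\<forall>r c. pi_free (relator s t r c) = 0"
    unfolding forall_pairs relator_def sum_pairs Lprod_def Lprod_rev_def pi_free_minus pi_free_add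
      pi_free_mult pi_free_const pi_free_gen mat_mult_left fst_conv snd_conv Rplus_explicit
    using assms
    by (elim insertE emptyE)
      (simp_all add: pi_gen_explicit vec_eq_iff forall_2 matrix_matrix_mult_def sum_2
        numeral_2_eq_2 numeral_3_eq_3)
  then show ?thesis by blast
qed

lemma coproduct_free_simps:
  "coproduct_free (p + q) = coproduct_free p + coproduct_free q"
  "coproduct_free (p - q) = coproduct_free p - coproduct_free q"
  "coproduct_free (sum f A) = (\<Sum>x\<in>A. coproduct_free (f x))"
  "coproduct_free (const c) = const c"
  "coproduct_free (gen g) = coproduct_gen g"
  by (simp_all add: coproduct_free_def extend_alg_add extend_alg_minus extend_alg_sum gen_def)

lemma coproduct_free_Lprod:
  "coproduct_free (Lprod s t r c) = (\<Sum>d\<in>UNIV. free_tensor (Lprod s t r d) (Lprod s t d c))"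
  "coproduct_free (Lprod_rev s t r c) = (\<Sum>d\<in>UNIV. free_tensor (Lprod_rev s t r d) (Lprod_rev s t d c))"
  by (simp_all add: Lprod_def Lprod_rev_def coproduct_free_mult coproduct_free_simps coproduct_gen_def
      sum_2 sum_pairs distrib_left distrib_right free_tensor_mult add_ac)

lemma coproduct_free_relator:
  "coproduct_free (relator s t r c) =
    (\<Sum>e\<in>UNIV. free_tensor (relator s t r e) (Lprod s t e c) + free_tensor (Lprod_rev s t r e) (relator s t e c))"
proof -
  define A where "A r c = (\<Sum>d\<in>UNIV. const (Rplus $ r $ d) * Lprod s t d c)" for r c
  define B where "B r c = (\<Sum>d\<in>UNIV. const (Rplus $ d $ c) * Lprod_rev s t r d)" for r c
  have rel: "relator s t r c = A r c - B r c" for r c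
    by (simp add: relator_def A_def B_def)
  have 1: "coproduct_free (A r c) = (\<Sum>e\<in>UNIV. free_tensor (A r e) (Lprod s t e c))"
    unfolding A_def coproduct_free_simps coproduct_free_mult coproduct_free_Lprod
      free_tensor_sum_left free_tensor_const sum_distrib_left
    by (rule sum.swap)
  have 2: "coproduct_free (B r c) = (\<Sum>e\<in>UNIV. free_tensor (Lprod_rev s t r e) (B e c))"
    unfolding B_def coproduct_free_simps coproduct_free_mult coproduct_free_Lprod
      free_tensor_sum_right free_tensor_const sum_distrib_left
    by (rule sum.swap)
  have 3: "(\<Sum>e\<in>UNIV. free_tensor (B r e) (Lprod s t e c)) = (\<Sum>e\<in>UNIV. free_tensor (Lprod_rev s t r e) (A e c))"
    unfolding A_def B_def free_tensor_sum_left free_tensor_sum_right free_tensor_const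
    by (rule sum.swap)
  show ?thesis
    unfolding rel coproduct_free_simps 1 2 free_tensor_diff_left free_tensor_diff_right sum.distrib sum_subtractf 3
    by simp
qed

lemma pi_free_ideal: "p \<in> s03_ideal \<Longrightarrow> pi_free p = 0"
  unfolding s03_ideal_def
proof (induction rule: ideal_gen.induct)
  case (ideal_gen_base s a b)
  then have "pi_free s = 0" by (auto simp: s03_relators_alt intro: pi_free_relator)
  then show ?case by (simp add: pi_free_mult)
qed (simp_all add: pi_free_add, simp add: pi_free_def)

lemma pi2_free_add: "pi2_free (p + q) = pi2_free p + pi2_free q"
  by (simp add: pi2_free_def extend_mat_add)

lemma pi2_free_minus: "pi2_free (p - q) = pi2_free p - pi2_free q"
  by (simp add: pi2_free_def extend_mat_minus)

lemma kron_zero [simp]: "kron 0 (A::complex^'q^'p) = 0" "kron (A::complex^'q^'p) 0 = 0"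
  by (simp_all add: vec_eq_iff kron_def)

lemma pi2_free_ideal: "p \<in> s03_ideal2 \<Longrightarrow> pi2_free p = 0"
  unfolding s03_ideal2_def
proof (induction rule: ideal_gen.induct)
  case (ideal_gen_base s a b)
  then have "pi2_free s = 0"
    by (auto simp: pi2_free_tensor pi_free_ideal s03_ideal_def ideal_gen_simple)
  then show ?case by (simp add: pi2_free_mult)
qed (simp_all add: pi2_free_add, simp add: pi2_free_def)

lemma free_tensor_ideal:
  assumes "p \<in> s03_ideal"
  shows "free_tensor p q \<in> s03_ideal2" "free_tensor q p \<in> s03_ideal2"
proof -
  have "free_tensor p 1 \<in> s03_ideal2 \<and> free_tensor 1 p \<in> s03_ideal2"
    using assms unfolding s03_ideal_def
  proof (induction rule: ideal_gen.induct)
    case (ideal_gen_base s a b)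
    have eq: "free_tensor (a * s * b) 1 = free_tensor a 1 * free_tensor s 1 * free_tensor b 1"
      "free_tensor 1 (a * s * b) = free_tensor 1 a * free_tensor 1 s * free_tensor 1 b"
      by (simp_all add: free_tensor_mult)
    show ?case unfolding eq s03_ideal2_def using ideal_gen_base
      by (auto intro!: ideal_gen.ideal_gen_base)
  qed (auto simp: free_tensor_add_left free_tensor_add_right s03_ideal2_def intro: ideal_gen.intros)
  moreover have "free_tensor p q = 1 * free_tensor p 1 * free_tensor 1 q"
    "free_tensor q p = 1 * free_tensor 1 p * free_tensor q 1"
    by (simp_all add: free_tensor_mult)
  ultimately show "free_tensor p q \<in> s03_ideal2" "free_tensor q p \<in> s03_ideal2"
    unfolding s03_ideal2_def by (metis ideal_gen_mult)+
qed

lemma coproduct_free_ideal: "p \<in> s03_ideal \<Longrightarrow> coproduct_free p \<in> s03_ideal2"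
  unfolding s03_ideal_def
proof (induction rule: ideal_gen.induct)
  case (ideal_gen_base p a b)
  then have "coproduct_free p \<in> s03_ideal2"
  proof -
    from ideal_gen_base obtain s t r c where p: "p = relator s t r c"
      and st: "(s, t) \<in> {(Plus, Plus), (Minus, Minus), (Plus, Minus)}"
      unfolding s03_relators_alt by blast
    have "relator s t r' c' \<in> s03_ideal" for r' c'
      unfolding s03_ideal_def s03_relators_alt using st by (blast intro: ideal_gen_simple)
    note 1 = free_tensor_ideal[OF this, unfolded s03_ideal2_def]
    show ?thesis unfolding p coproduct_free_relator s03_ideal2_def
      by (intro ideal_gen_sum ideal_gen_add 1)
  qed
  then show ?case by (simp add: coproduct_free_mult s03_ideal2_def ideal_gen_mult)
next
  case ideal_gen_zero
  then show ?case by (simp add: coproduct_free_def s03_ideal2_def ideal_gen.intros)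
next
  case (ideal_gen_add x y)
  then show ?case by (simp add: coproduct_free_simps s03_ideal2_def ideal_gen.ideal_gen_add)
qed


section \<open>The algebra, its coproduct and its fundamental representation\<close>

quotient_type s03F = "s03_gen free_alg" / "\<lambda>p q. p - q \<in> s03_ideal"
  unfolding s03_ideal_def by (rule ideal_gen_equivp)

text \<open>The tensor product of the algebra with itself.\<close>

quotient_type s03F2 = "s03_gen free_alg2" / "\<lambda>p q. p - q \<in> s03_ideal2"
  unfolding s03_ideal2_def by (rule ideal_gen_equivp)

instantiation s03F :: ring_1
begin
lift_definition zero_s03F :: s03F is 0 .
lift_definition one_s03F :: s03F is 1 .
lift_definition plus_s03F :: "s03F \<Rightarrow> s03F \<Rightarrow> s03F" is "(+)"
  unfolding s03_ideal_def by (rule ideal_gen_cong_add)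
lift_definition minus_s03F :: "s03F \<Rightarrow> s03F \<Rightarrow> s03F" is "(-)"
  unfolding s03_ideal_def by (rule ideal_gen_cong_diff)
lift_definition uminus_s03F :: "s03F \<Rightarrow> s03F" is uminus
  unfolding s03_ideal_def by (rule ideal_gen_cong_uminus)
lift_definition times_s03F :: "s03F \<Rightarrow> s03F \<Rightarrow> s03F" is "(*)"
  unfolding s03_ideal_def by (rule ideal_gen_cong_mult)
instance
proof
  show "(0::s03F) \<noteq> 1"
  proof transfer
    have "pi_free (0 - 1) \<noteq> 0"
      unfolding pi_free_minus using pi_free_const[of 0] pi_free_const[of 1]
      by (simp add: vec_eq_iff mat_def)
    then show "0 - 1 \<notin> s03_ideal" using pi_free_ideal by blast
  qed
qed (transfer, simp add: algebra_simps s03_ideal_def ideal_gen_zero)+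
end

instantiation s03F2 :: ring_1
begin
lift_definition zero_s03F2 :: s03F2 is 0 .
lift_definition one_s03F2 :: s03F2 is 1 .
lift_definition plus_s03F2 :: "s03F2 \<Rightarrow> s03F2 \<Rightarrow> s03F2" is "(+)"
  unfolding s03_ideal2_def by (rule ideal_gen_cong_add)
lift_definition minus_s03F2 :: "s03F2 \<Rightarrow> s03F2 \<Rightarrow> s03F2" is "(-)"
  unfolding s03_ideal2_def by (rule ideal_gen_cong_diff)
lift_definition uminus_s03F2 :: "s03F2 \<Rightarrow> s03F2" is uminus
  unfolding s03_ideal2_def by (rule ideal_gen_cong_uminus)
lift_definition times_s03F2 :: "s03F2 \<Rightarrow> s03F2 \<Rightarrow> s03F2" is "(*)"
  unfolding s03_ideal2_def by (rule ideal_gen_cong_mult)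
instance
proof
  show "(0::s03F2) \<noteq> 1"
  proof transfer
    have "pi2_free (0 - 1) \<noteq> 0"
      unfolding pi2_free_minus using pi2_free_tensor[of 1 1] pi_free_const[of 1]
      by (simp add: free_tensor_one) (simp add: pi2_free_def vec_eq_iff mat_def)
    then show "0 - 1 \<notin> s03_ideal2" using pi2_free_ideal by blast
  qed
qed (transfer, simp add: algebra_simps s03_ideal2_def ideal_gen_zero)+
end

lift_definition s03_scalar :: "complex \<Rightarrow> s03F" is const .

lift_definition L :: "pm \<Rightarrow> 2 \<Rightarrow> 2 \<Rightarrow> s03F" is "\<lambda>s i j. gen (Lgen s i j)" .

lift_definition tensor :: "s03F \<Rightarrow> s03F \<Rightarrow> s03F2" is free_tensor
proof -
  fix p p' q q' :: "s03_gen free_alg"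
  assume 1: "p - p' \<in> s03_ideal" "q - q' \<in> s03_ideal"
  have "free_tensor p q - free_tensor p' q' = free_tensor (p - p') q + free_tensor p' (q - q')"
    by (simp add: free_tensor_diff_left free_tensor_diff_right)
  then show "free_tensor p q - free_tensor p' q' \<in> s03_ideal2"
    using free_tensor_ideal(1)[OF 1(1)] free_tensor_ideal(2)[OF 1(2)]
    by (simp add: s03_ideal2_def ideal_gen_add)
qed

lift_definition coproduct :: "s03F \<Rightarrow> s03F2" is coproduct_free
  by (metis coproduct_free_ideal coproduct_free_simps(2))

lift_definition pi_fund :: "s03F \<Rightarrow> mat2" is pi_free
  by (metis pi_free_ideal pi_free_minus eq_iff_diff_eq_0)

text \<open>The map \<open>\<pi> \<otimes> \<pi>\<close> on the tensor product of the algebra with itself.\<close>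

lift_definition pi_tensor_pi :: "s03F2 \<Rightarrow> mat4" is pi2_free
  by (metis pi2_free_ideal pi2_free_minus eq_iff_diff_eq_0)

lemma s03_relations:
  assumes "(s, t) \<in> {(Plus, Plus), (Minus, Minus), (Plus, Minus)}"
  shows "map_matrix s03_scalar Rplus ** kron (\<chi> i j. L s i j) (mat 1) ** kron (mat 1) (\<chi> i j. L t i j)
       = kron (mat 1) (\<chi> i j. L t i j) ** kron (\<chi> i j. L s i j) (mat 1) ** map_matrix s03_scalar Rplus"
proof -
  define SL where "SL s = (\<chi> i j. L s i j)" for s
  have SL: "SL s $ i $ j = abs_s03F (Lmat s $ i $ j)" for s i j
    by (simp add: SL_def Lmat_def L.abs_eq)
  have mult: "(map_matrix abs_s03F A :: s03F^(2\<times>2)^(2\<times>2)) ** map_matrix abs_s03F B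
    = map_matrix abs_s03F (A ** B)" for A B :: "s03_gen free_alg^(2\<times>2)^(2\<times>2)"
    unfolding vec_eq_iff matrix_matrix_mult_def sum_pairs
    by (simp add: plus_s03F.abs_eq times_s03F.abs_eq)
  have k: "kron (SL s) (mat 1) = map_matrix abs_s03F (kron (Lmat s) (mat 1))"
    "kron (mat 1) (SL s) = map_matrix abs_s03F (kron (mat 1) (Lmat s))" for s
    by (simp_all add: vec_eq_iff kron_def SL mat_def times_s03F.abs_eq zero_s03F_def one_s03F_def)
  have r: "map_matrix s03_scalar Rplus = map_matrix abs_s03F (map_matrix const Rplus)"
    by (simp add: vec_eq_iff s03_scalar.abs_eq)
  have "map_matrix abs_s03F (map_matrix const Rplus ** kron (Lmat s) (mat 1) ** kron (mat 1) (Lmat t))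
    = map_matrix abs_s03F (kron (mat 1) (Lmat t) ** kron (Lmat s) (mat 1) ** map_matrix const Rplus)"
    (is "map_matrix _ ?X = map_matrix _ ?Y")
  proof -
    have "?X $ r $ c - ?Y $ r $ c \<in> s03_ideal" for r c
    proof -
      have "(?X - ?Y) $ r $ c \<in> s03_relators" unfolding s03_relators_def using assms by blast
      then show ?thesis by (simp add: s03_ideal_def ideal_gen_simple)
    qed
    then show ?thesis unfolding vec_eq_iff nth_map_matrix by (simp add: s03F.abs_eq_iff)
  qed
  then show ?thesis unfolding SL_def[symmetric] k r mult by simp
qed

lemma coproduct_hom:
  "coproduct (a + b) = coproduct a + coproduct b"
  "coproduct (a * b) = coproduct a * coproduct b"
  "coproduct 1 = 1"
  "coproduct (s03_scalar c) = tensor (s03_scalar c) 1"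
  "coproduct (L s i j) = (\<Sum>k\<in>UNIV. tensor (L s i k) (L s k j))"
proof -
  have 1: "coproduct_free 1 = 1" using coproduct_free_simps(4)[of 1] by simp
  have 2: "free_tensor (const c) 1 = (const c :: s03_gen free_alg2)" for c
    using free_tensor_single[of "0 :: s03_gen word" c "0 :: s03_gen word" 1]
    by (simp add: zero_prod_def[symmetric])
  show "coproduct (a + b) = coproduct a + coproduct b"
    by transfer (simp add: coproduct_free_simps s03_ideal2_def ideal_gen_zero)
  show "coproduct (a * b) = coproduct a * coproduct b"
    by transfer (simp add: coproduct_free_mult s03_ideal2_def ideal_gen_zero)
  show "coproduct 1 = 1" by transfer (simp add: 1 s03_ideal2_def ideal_gen_zero)
  show "coproduct (s03_scalar c) = tensor (s03_scalar c) 1"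
    by transfer (simp add: coproduct_free_simps 2 s03_ideal2_def ideal_gen_zero)
  show "coproduct (L s i j) = (\<Sum>k\<in>UNIV. tensor (L s i k) (L s k j))"
    unfolding sum_2
    by transfer (simp add: coproduct_free_simps coproduct_gen_def sum_2 s03_ideal2_def ideal_gen_zero)
qed

lemma pi_fund_hom:
  "pi_fund (a + b) = pi_fund a + pi_fund b"
  "pi_fund (a * b) = pi_fund a ** pi_fund b"
  "pi_fund (s03_scalar c) = mat c"
  by (transfer, simp add: pi_free_add pi_free_mult pi_free_const)+

lemma pi_fund_L:
  "pi_fund (L Plus i j) $ m $ p = (flip ** Rmat ** flip) $ (i, m) $ (j, p)"
  "pi_fund (L Minus i j) $ m $ p = matrix_inv Rmat $ (i, m) $ (j, p)"
  by (transfer, simp add: pi_free_gen pi_gen_def Rplus_def)+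

lemma pi_tensor_pi_hom:
  "pi_tensor_pi (x + y) = pi_tensor_pi x + pi_tensor_pi y"
  "pi_tensor_pi (x * y) = pi_tensor_pi x ** pi_tensor_pi y"
  "pi_tensor_pi (tensor a b) = kron (pi_fund a) (pi_fund b)"
  by (transfer, simp add: pi2_free_add pi2_free_mult pi2_free_tensor)+

end

theory Submission
  imports Defs
begin

text \<open>Everything reduces to one matrix \<open>J\<close> with \<open>J\<^sup>2 = -1\<close>: one has
  \<open>Rhat = (1 + J) / \<surd>2\<close>, so \<open>Rhat\<^sup>-\<^sup>1 = (1 - J) / \<surd>2\<close> and
  \<open>Rhat(x) = ((1 + x) + (1 - x) J) / \<surd>(2x)\<close>. For \<open>x \<noteq> 1\<close> the eigenspaces of \<open>Rhat(x)\<close> are therefore those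
  of \<open>J\<close> at \<open>\<mp>\<i>\<close>, and the projectors are \<open>(1 \<plusminus> \<i> J) / 2\<close>, independently of \<open>x\<close>. Since \<open>J\<close> commutes with
  the images of the generators, and the coproduct is multiplicative, \<open>J\<close> commutes with the image of
  the whole algebra.\<close>

section \<open>Matrices with square \<open>-1\<close>\<close>

lemma mat_scale_vector: "(c *\<^sub>M A) *v v = c *s (A *v v)"
  by (simp add: vec_eq_iff matrix_vector_mult_def sum_distrib_left mult_ac)

lemma mat_vector: "(mat c :: complex^'n^'n) *v v = c *s v"
  by (simp add: vec_eq_iff matrix_vector_mult_def mat_def if_distrib[of "\<lambda>x. x * _"] cong: if_cong)

lemma mat_mult_right: "A ** (mat c :: complex^'n^'n) = c *\<^sub>M A"
  by (simp add: vec_eq_iff matrix_matrix_mult_def mat_def if_distrib[of "\<lambda>x. _ * x"] cong: if_cong)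

lemma mat_scale_mult_left: "(c *\<^sub>M A) ** B = c *\<^sub>M (A ** B)"
  by (simp add: vec_eq_iff matrix_matrix_mult_def sum_distrib_left mult_ac)

lemma mat_scale_mult_right: "A ** (c *\<^sub>M B) = c *\<^sub>M (A ** B)"
  by (simp add: vec_eq_iff matrix_matrix_mult_def sum_distrib_left mult_ac)

lemma matrix_mul_commuting_mult:
  fixes A B C :: "complex^'n^'n"
  assumes "A ** B = B ** A" "A ** C = C ** A"
  shows "A ** (B ** C) = (B ** C) ** A"
proof -
  have "A ** (B ** C) = B ** (A ** C)"
    by (simp add: matrix_mul_assoc assms(1))
  also have "\<dots> = (B ** C) ** A"
    by (simp add: matrix_mul_assoc assms(2))
  finally show ?thesis .
qed

text \<open>Scalar matrices are central, so only the \<open>J\<close> part matters.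
  \<open>Rhat\<close> and both projectors have this affine shape.\<close>

lemma commutator_affine:
  "J ** B = B ** J \<Longrightarrow> commutator (c *\<^sub>M (mat a + b *\<^sub>M J)) B = 0"
  by (simp add: commutator_def mat_scale_mult_left mat_scale_mult_right mat_mul_add_right
      matrix_add_ldistrib mat_mult_left mat_mult_right)

lemma eigenspace_invariant:
  assumes "commutator A B = 0" "v \<in> eigenspace A c"
  shows "B *v v \<in> eigenspace A c"
proof -
  have "A ** B = B ** A" using assms(1) by (simp add: commutator_def)
  then have "A *v (B *v v) = B *v (A *v v)" by (simp add: matrix_vector_mul_assoc)
  then show ?thesis using assms(2) by (simp add: eigenspace_def vector_scalar_commute)
qed

text \<open>The shift by \<open>a\<close> cancels and \<open>b\<close> can be divided out. This
  identifies the eigenspaces of \<open>Rhat_x rt x\<close> with those of one fixed matrix.\<close>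

lemma eigenspace_affine:
  assumes "b \<noteq> 0"
  shows "eigenspace (mat a + b *\<^sub>M J) (a + b * e) = eigenspace J e"
  by (simp add: assms eigenspace_def matrix_vector_mult_add_rdistrib mat_vector mat_scale_vector
      vec_eq_iff distrib_right mult.assoc)

lemma is_eigenvalue_iff: "is_eigenvalue A c \<longleftrightarrow> (\<exists>v\<in>eigenspace A c. v \<noteq> 0)"
  by (auto simp: is_eigenvalue_def eigenspace_def)

text \<open>For \<open>J\<close> and \<open>e\<close> with square -1 this is the projector onto the
  eigenspace of \<open>J\<close> at \<open>e\<close> along the one at \<open>- e\<close>.\<close>

definition half_proj :: "complex^'n^'n \<Rightarrow> complex \<Rightarrow> complex^'n^'n"
  where "half_proj J e = (1 / 2) *\<^sub>M (mat 1 + (- e) *\<^sub>M J)"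

lemma half_proj_vector: "half_proj J e *v v = (1 / 2) *s (v - e *s (J *v v))"
  by (simp add: half_proj_def mat_scale_vector matrix_vector_mult_add_rdistrib vec_eq_iff)

lemma half_proj_sum: "half_proj J e + half_proj J (- e) = mat 1"
  by (simp add: half_proj_def vec_eq_iff mat_def field_simps)

text \<open>The quotient is \<open>(J + e) / (2 e)\<close>, and \<open>1 / e = - e\<close>. That
  \<open>a\<close> and \<open>b\<close> cancel is why the projectors do not depend on
  \<open>x\<close>.\<close>

lemma affine_half_proj:
  assumes "b \<noteq> 0" "e * e = - 1"
  shows "(1 / ((a + b * e) - (a + b * (- e)))) *\<^sub>M (mat a + b *\<^sub>M J - mat (a + b * (- e))) = half_proj J e"
proof -
  have "e \<noteq> 0" using assms(2) by auto
  have ee: "e * (e * y) = - y" for y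
    by (metis assms(2) mult.assoc mult_minus1)
  define q where "q = 1 / ((a + b * e) - (a + b * (- e)))"
  \<comment> \<open>As \<open>q = 1 / (2 b e)\<close>, these are the coefficients of
    \<open>J\<close> and of the identity; \<open>y\<close> stands for a matrix entry.\<close>
  have q: "q * (b * y) = - e / 2 * y" "q * (b * e * y) = 1 / 2 * y" for y
    using assms(1) \<open>e \<noteq> 0\<close> by (simp_all add: q_def field_simps ee)
  have m: "mat a + b *\<^sub>M J - mat (a + b * (- e)) = b *\<^sub>M J + (b * e) *\<^sub>M mat 1"
    by (simp add: vec_eq_iff mat_def)
  show ?thesis
    unfolding q_def[symmetric] m half_proj_def
    by (simp only: vec_eq_iff mat_scale_nth vector_add_component distrib_left q) simp
qed

context
  fixes J :: "complex^'n^'n" and e :: complex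
  assumes J: "J ** J = mat (- 1)" and e: "e * e = - 1"
begin

lemma square_neg_one_vector: "J *v (J *v v) = - v"
  by (simp add: matrix_vector_mul_assoc J mat_vector vec_eq_iff)

text \<open>In the square of \<open>1 - e J\<close> the last term \<open>(e * e) J J\<close> equals
  1, which leaves \<open>2 (1 - e J)\<close>.\<close>

lemma half_proj_idem: "half_proj J e ** half_proj J e = half_proj J e"
proof -
  have "half_proj J e ** half_proj J e
      = (1 / 4) *\<^sub>M (mat 1 + (- 2 * e) *\<^sub>M J + (e * e) *\<^sub>M (J ** J))"
    by (simp add: half_proj_def mat_scale_mult_left mat_scale_mult_right mat_mul_add_right
        matrix_add_ldistrib vec_eq_iff algebra_simps)
  also have "\<dots> = half_proj J e"
    by (simp add: J e half_proj_def vec_eq_iff mat_def)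
  finally show ?thesis .
qed

text \<open>Vanishing means \<open>v = e J v\<close>; multiplying by \<open>- e\<close> turns this
  into the eigenvalue equation.\<close>

lemma half_proj_kernel: "half_proj J e *v v = 0 \<longleftrightarrow> v \<in> eigenspace J (- e)"
proof -
  have "y = e * z \<longleftrightarrow> z = - e * y" for y z :: complex
    using e by (metis (no_types) minus_mult_left minus_mult_right mult.assoc mult_1 add.inverse_inverse)
  then show ?thesis
    by (simp add: half_proj_vector eigenspace_def vec_eq_iff)
qed

text \<open>\<open>J\<close> maps \<open>v - e J v\<close> to \<open>J v + e v\<close>, which is
  \<open>e\<close> times it; conversely, eigenvectors at \<open>e\<close> are fixed.\<close>

lemma half_proj_range: "range (\<lambda>v. half_proj J e *v v) = eigenspace J e"
proof (intro equalityI subsetI)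
  fix w assume "w \<in> range (\<lambda>v. half_proj J e *v v)"
  then obtain v where w: "w = (1 / 2) *s (v - e *s (J *v v))"
    by (auto simp: half_proj_vector)
  have "J *v w = (1 / 2) *s (J *v v - e *s (J *v (J *v v)))"
    by (simp add: w matrix_vector_mult_diff_distrib vector_scalar_commute[symmetric])
  also have "\<dots> = e *s w"
    using e by (simp add: square_neg_one_vector w vec_eq_iff algebra_simps flip: mult.assoc)
  finally show "w \<in> eigenspace J e"
    by (simp add: eigenspace_def)
next
  fix w assume "w \<in> eigenspace J e"
  then have "half_proj J e *v w = w"
    using e by (simp add: half_proj_vector eigenspace_def vec_eq_iff flip: mult.assoc)
  then show "w \<in> range (\<lambda>v. half_proj J e *v v)"
    by (metis rangeI)
qed

text \<open>Applying \<open>J\<close> twice to an eigenvector gives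
  \<open>d * d = - 1 = e * e\<close>, and the difference of squares factors.\<close>

lemma eigenvalue_square_neg_one:
  assumes "v \<in> eigenspace J d" "v \<noteq> 0"
  shows "d = e \<or> d = - e"
proof -
  have "- v = J *v (J *v v)"
    by (simp add: square_neg_one_vector)
  also have "\<dots> = d *s (d *s v)"
    using assms(1) by (simp add: eigenspace_def vector_scalar_commute)
  finally have "- v = (d * d) *s v"
    by simp
  moreover obtain k where "v $ k \<noteq> 0"
    using assms(2) by (auto simp: vec_eq_iff)
  ultimately have "- (v $ k) = (d * d) * v $ k"
    by (metis vector_smult_component uminus_vec_def vec_lambda_beta)
  then have "(d * d + 1) * v $ k = 0"
    by (metis add.left_inverse add.commute distrib_right mult_1)
  with \<open>v $ k \<noteq> 0\<close> have "d * d + 1 = 0"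
    by simp
  then have "(d - e) * (d + e) = 0"
    by (simp add: algebra_simps e)
  then show ?thesis
    by (auto simp: eq_neg_iff_add_eq_0)
qed

end

section \<open>The braid matrix\<close>

definition Jmat :: mat4
  where "Jmat = (\<chi> r c. [[0, 0, 0, 1], [0, 0, -1, 0], [0, 1, 0, 0], [-1, 0, 0, 0]] ! pos r ! pos c)"

lemma Jmat_square: "Jmat ** Jmat = mat (- 1)"
  unfolding vec_eq_iff forall_pairs matrix_matrix_mult_def sum_pairs Jmat_def mat_def
  by (simp add: numeral_2_eq_2 numeral_3_eq_3)

text \<open>The factor \<open>1\<close> before \<open>Jmat\<close> is kept so that
  \<open>commutator_affine\<close> applies by unification.\<close>

lemma Rhat_eq: "Rhat = (1 / complex_of_real (sqrt 2)) *\<^sub>M (mat 1 + 1 *\<^sub>M Jmat)"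
  unfolding Rhat_def vec_eq_iff forall_pairs matrix_matrix_mult_def sum_pairs Rmat_def flip_def
    Jmat_def mat_def
  by (simp add: numeral_2_eq_2 numeral_3_eq_3)

lemma Rhat_inv: "matrix_inv Rhat = (1 / complex_of_real (sqrt 2)) *\<^sub>M (mat 1 + (- 1) *\<^sub>M Jmat)"
proof -
  \<comment> \<open>The sign \<open>e\<close> covers both orders of the product:
    \<open>e = 1\<close> and \<open>e = - 1\<close> give the right and the left inverse.\<close>
  have "(1 / complex_of_real (sqrt 2)) *\<^sub>M (mat 1 + e *\<^sub>M Jmat)
      ** (1 / complex_of_real (sqrt 2)) *\<^sub>M (mat 1 + (- e) *\<^sub>M Jmat) = mat 1" if "e * e = 1" for e
  proof -
    have "(mat 1 + e *\<^sub>M Jmat) ** (mat 1 + (- e) *\<^sub>M Jmat) = mat 1 + (- (e * e)) *\<^sub>M (Jmat ** Jmat)"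
      by (simp add: mat_mul_add_right matrix_add_ldistrib mat_scale_mult_left mat_scale_mult_right
          vec_eq_iff algebra_simps)
    also have "\<dots> = mat 2"
      by (simp add: that Jmat_square vec_eq_iff mat_def)
    finally have m: "(mat 1 + e *\<^sub>M Jmat) ** (mat 1 + (- e) *\<^sub>M Jmat) = mat 2" .
    show ?thesis
      unfolding mat_scale_mul m by (simp add: vec_eq_iff mat_def sqrt2_sq)
  qed
  from this[of 1] this[of "- 1"] show ?thesis
    unfolding Rhat_eq by (intro matrix_inv_unique) simp_all
qed

lemma Rhat_x_eq:
  assumes "rt x ^ 2 = x" "x \<noteq> 0"
  shows "Rhat_x rt x = mat ((1 + x) / (complex_of_real (sqrt 2) * rt x))
    + ((1 - x) / (complex_of_real (sqrt 2) * rt x)) *\<^sub>M Jmat"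
proof -
  have "rt x \<noteq> 0" using assms by auto
  moreover have "rt x * rt x = x" using assms(1) by (simp add: power2_eq_square)
  \<comment> \<open>Rewriting \<open>rt x\<close> this way gives both summands of
    \<open>Rhat_x\<close> the denominator \<open>rt x\<close>.\<close>
  ultimately have "x / rt x = rt x"
    by (simp add: field_simps)
  then have *: "Rhat_x rt x = (1 / rt x) *\<^sub>M Rhat + (x / rt x) *\<^sub>M matrix_inv Rhat"
    by (simp add: Rhat_x_def inverse_eq_divide)
  show ?thesis
    unfolding * Rhat_inv unfolding Rhat_eq
    by (simp add: vec_eq_iff mat_def algebra_simps add_divide_distrib diff_divide_distrib)
qed

text \<open>In the form \<open>a + b * e\<close>, \<open>mu1\<close> belongs to the eigenvalue
  \<open>- \<i>\<close> of \<open>Jmat\<close> and \<open>mu2\<close> to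
  \<open>\<i>\<close>.\<close>

lemma mu_eq:
  "mu1 rt x = (1 + x) / (complex_of_real (sqrt 2) * rt x) + (1 - x) / (complex_of_real (sqrt 2) * rt x) * (- \<i>)"
  "mu2 rt x = (1 + x) / (complex_of_real (sqrt 2) * rt x) + (1 - x) / (complex_of_real (sqrt 2) * rt x) * \<i>"
  by (simp_all add: mu1_def mu2_def add_divide_distrib diff_divide_distrib algebra_simps)

lemma Pi_eq:
  assumes "rt x ^ 2 = x" "x \<notin> {0, 1}"
  shows "Pi1 rt x = half_proj Jmat (- \<i>)" "Pi2 rt x = half_proj Jmat \<i>"
proof -
  define b where "b = (1 - x) / (complex_of_real (sqrt 2) * rt x)"
  have b: "b \<noteq> 0" using assms by (auto simp: b_def)
  show "Pi1 rt x = half_proj Jmat (- \<i>)"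
    using affine_half_proj[OF b, of "- \<i>"] assms by (simp add: Pi1_def mu_eq Rhat_x_eq b_def)
  show "Pi2 rt x = half_proj Jmat \<i>"
    using affine_half_proj[OF b, of \<i>] assms by (simp add: Pi2_def mu_eq Rhat_x_eq b_def)
qed

lemma eigenspace_Rhat_x:
  assumes "rt x ^ 2 = x" "x \<notin> {0, 1}"
  shows "eigenspace (Rhat_x rt x) (mu1 rt x) = eigenspace Jmat (- \<i>)"
    and "eigenspace (Rhat_x rt x) (mu2 rt x) = eigenspace Jmat \<i>"
proof -
  have b: "(1 - x) / (complex_of_real (sqrt 2) * rt x) \<noteq> 0" using assms by auto
  have R: "Rhat_x rt x = mat ((1 + x) / (complex_of_real (sqrt 2) * rt x))
      + ((1 - x) / (complex_of_real (sqrt 2) * rt x)) *\<^sub>M Jmat"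
    using assms by (intro Rhat_x_eq) auto
  show "eigenspace (Rhat_x rt x) (mu1 rt x) = eigenspace Jmat (- \<i>)"
    "eigenspace (Rhat_x rt x) (mu2 rt x) = eigenspace Jmat \<i>"
    unfolding mu_eq R by (rule eigenspace_affine[OF b])+
qed

lemma is_eigenvalue_Jmat: "is_eigenvalue Jmat \<i>" "is_eigenvalue Jmat (- \<i>)"
proof -
  \<comment> \<open>\<open>Jmat\<close> sends \<open>(1, 0, 0, e)\<close> to
    \<open>(e, 0, 0, -1)\<close>, which is \<open>e\<close> times it when
    \<open>e * e = - 1\<close>.\<close>
  define v :: "complex \<Rightarrow> complex^(2 \<times> 2)" where "v e = (\<chi> r. [1, 0, 0, e] ! pos r)" for e
  have "v e $ (1, 1) = 1" for e
    by (simp add: v_def)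
  then have nz: "v e \<noteq> 0" for e
    by (metis zero_index zero_neq_one)
  have "Jmat *v v e = e *s v e" if "e * e = - 1" for e
    using that unfolding vec_eq_iff forall_pairs matrix_vector_mult_def sum_pairs Jmat_def v_def
    by (simp add: numeral_2_eq_2 numeral_3_eq_3)
  from this[of \<i>] this[of "- \<i>"] show "is_eigenvalue Jmat \<i>" "is_eigenvalue Jmat (- \<i>)"
    unfolding is_eigenvalue_def using nz by auto
qed

lemma eigenvalues_Rhat_x:
  assumes "rt x ^ 2 = x" "x \<notin> {0, 1}"
  shows "{c. is_eigenvalue (Rhat_x rt x) c} = {mu1 rt x, mu2 rt x}"
proof (intro equalityI subsetI)
  fix c assume "c \<in> {c. is_eigenvalue (Rhat_x rt x) c}"
  then obtain v where v: "v \<in> eigenspace (Rhat_x rt x) c" "v \<noteq> 0"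
    by (auto simp: is_eigenvalue_iff)
  define a b where "a = (1 + x) / (complex_of_real (sqrt 2) * rt x)"
    and "b = (1 - x) / (complex_of_real (sqrt 2) * rt x)"
  have b: "b \<noteq> 0" using assms by (auto simp: b_def)
  \<comment> \<open>Since \<open>b\<close> is nonzero, any \<open>c\<close> has the form required by
    \<open>eigenspace_affine\<close>.\<close>
  then have c: "c = a + b * ((c - a) / b)"
    by simp
  have "Rhat_x rt x = mat a + b *\<^sub>M Jmat"
    using assms by (simp add: Rhat_x_eq a_def b_def)
  then have "v \<in> eigenspace Jmat ((c - a) / b)"
    using v(1) c eigenspace_affine[OF b] by metis
  then have "(c - a) / b = \<i> \<or> (c - a) / b = - \<i>"
    using eigenvalue_square_neg_one[OF Jmat_square, of \<i>] v(2) by simp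
  then show "c \<in> {mu1 rt x, mu2 rt x}"
    using c unfolding mu_eq a_def[symmetric] b_def[symmetric] by (metis insert_iff)
next
  fix c assume "c \<in> {mu1 rt x, mu2 rt x}"
  then show "c \<in> {c. is_eigenvalue (Rhat_x rt x) c}"
    using is_eigenvalue_Jmat by (auto simp: is_eigenvalue_iff eigenspace_Rhat_x[of rt x, OF assms])
qed

section \<open>Commutation with the tensor square\<close>

text \<open>The one commutation fact checked by computation, entry by entry on the explicit
  generator matrices.\<close>

lemma Jmat_commute_gen:
  "Jmat ** (\<Sum>k\<in>UNIV. kron (pi_gen (Lgen s i k)) (pi_gen (Lgen s k j)))
    = (\<Sum>k\<in>UNIV. kron (pi_gen (Lgen s i k)) (pi_gen (Lgen s k j))) ** Jmat"
proof -
  \<comment> \<open>Quantifying over \<open>i\<close> and \<open>j\<close> lets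
    \<open>forall_2\<close> split the claim into concrete index cases.\<close>
  have "\<forall>i j. Jmat ** (\<Sum>k\<in>UNIV. kron (pi_gen (Lgen s i k)) (pi_gen (Lgen s k j)))
    = (\<Sum>k\<in>UNIV. kron (pi_gen (Lgen s i k)) (pi_gen (Lgen s k j))) ** Jmat"
    unfolding forall_2 sum_2 vec_eq_iff forall_pairs matrix_matrix_mult_def sum_pairs
    by (cases s) (simp_all add: pi_gen_explicit kron_def Jmat_def numeral_2_eq_2 numeral_3_eq_3)
  then show ?thesis by blast
qed

lemma pi_fund_L_gen: "pi_fund (L s i j) = pi_gen (Lgen s i j)"
  by transfer (rule pi_free_gen)

lemma pi2_coproduct_gen:
  "pi2_free (coproduct_gen (Lgen s i j)) = (\<Sum>k\<in>UNIV. kron (pi_gen (Lgen s i k)) (pi_gen (Lgen s k j)))"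
  by (simp add: coproduct_gen_def sum_2 pi2_free_add pi2_free_tensor pi_free_gen)

lemma pi2_free_const: "pi2_free (const c) = mat c"
  by (simp add: pi2_free_def zero_prod_def) (simp add: vec_eq_iff mat_def)

text \<open>The matrices commuting with \<open>Jmat\<close> are closed under products, and both
  \<open>pi2_free\<close> and \<open>word_alg\<close> turn concatenation into products.\<close>

lemma Jmat_commute_word:
  "Jmat ** pi2_free (word_alg coproduct_gen (Word gs)) = pi2_free (word_alg coproduct_gen (Word gs)) ** Jmat"
proof (induction gs)
  case Nil
  show ?case
    using pi2_free_const[of 1] by (simp add: word_alg_def)
next
  case (Cons g gs)
  obtain s i j where g: "g = Lgen s i j" by (cases g)
  have "Jmat ** pi2_free (coproduct_gen g) = pi2_free (coproduct_gen g) ** Jmat"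
    unfolding g pi2_coproduct_gen by (rule Jmat_commute_gen)
  moreover have "word_alg coproduct_gen (Word (g # gs)) = coproduct_gen g * word_alg coproduct_gen (Word gs)"
    by (simp add: word_alg_def)
  ultimately show ?case
    using matrix_mul_commuting_mult Cons.IH by (simp only: pi2_free_mult)
qed

lemma Jmat_commute_free:
  "Jmat ** pi2_free (coproduct_free p) = pi2_free (coproduct_free p) ** Jmat"
proof (induction p rule: pm_induct)
  case (single w c)
  then show ?case
    using Jmat_commute_word[of "letters w"]
    by (simp add: coproduct_free_def pi2_free_mult pi2_free_const mat_mult_left mat_scale_mult_left
        mat_scale_mult_right)
next
  case (add p q)
  then show ?case
    by (simp add: coproduct_free_simps pi2_free_add matrix_add_ldistrib mat_mul_add_right)
qed

lemma Jmat_commute: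
  "Jmat ** pi_tensor_pi (coproduct a) = pi_tensor_pi (coproduct a) ** Jmat"
  by transfer (rule Jmat_commute_free)

theorem mainTheorem3:
  fixes rt :: "complex \<Rightarrow> complex"
  assumes rt: "\<And>x. rt x ^ 2 = x"
  shows
    "(\<forall>x. x \<notin> {0, 1} \<longrightarrow>
        mu1 rt x \<noteq> mu2 rt x \<and>
        {c. is_eigenvalue (Rhat_x rt x) c} = {mu1 rt x, mu2 rt x})
   \<and> (\<forall>x y. x \<notin> {0, 1} \<longrightarrow> y \<notin> {0, 1} \<longrightarrow>
        Pi1 rt x = Pi1 rt y \<and> Pi2 rt x = Pi2 rt y)
   \<and> (\<forall>x. x \<notin> {0, 1} \<longrightarrow>
        Pi1 rt x ** Pi1 rt x = Pi1 rt x \<and>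
        Pi2 rt x ** Pi2 rt x = Pi2 rt x \<and>
        Pi1 rt x + Pi2 rt x = mat 1 \<and>
        range (\<lambda>v. Pi1 rt x *v v) = eigenspace (Rhat_x rt x) (mu1 rt x) \<and>
        range (\<lambda>v. Pi2 rt x *v v) = eigenspace (Rhat_x rt x) (mu2 rt x) \<and>
        (\<forall>v. Pi1 rt x *v v = 0 \<longleftrightarrow> v \<in> eigenspace (Rhat_x rt x) (mu2 rt x)) \<and>
        (\<forall>v. Pi2 rt x *v v = 0 \<longleftrightarrow> v \<in> eigenspace (Rhat_x rt x) (mu1 rt x)))
   \<and> (\<forall>x s i j. x \<notin> {0, 1} \<longrightarrow>
        commutator (Pi1 rt x)
          (\<Sum>k\<in>UNIV. kron (pi_fund (L s i k)) (pi_fund (L s k j))) = 0 \<and>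
        commutator (Pi2 rt x)
          (\<Sum>k\<in>UNIV. kron (pi_fund (L s i k)) (pi_fund (L s k j))) = 0)
   \<and> (\<forall>x a. x \<notin> {0, 1} \<longrightarrow>
        commutator (Pi1 rt x) (pi_tensor_pi (coproduct a)) = 0 \<and>
        commutator (Pi2 rt x) (pi_tensor_pi (coproduct a)) = 0)
   \<and> (\<forall>c a v. is_eigenvalue Rhat c \<longrightarrow> v \<in> eigenspace Rhat c \<longrightarrow>
        pi_tensor_pi (coproduct a) *v v \<in> eigenspace Rhat c)"
proof (intro conjI allI impI)
  fix x assume x: "x \<notin> {0, 1 :: complex}"
  note sp = eigenspace_Rhat_x[of rt x, OF rt x]
  note pr = Pi_eq[of rt x, OF rt x]
  have i: "\<i> * \<i> = - 1" "- \<i> * - \<i> = - 1" by simp_all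
  show "mu1 rt x \<noteq> mu2 rt x"
    \<comment> \<open>The two values differ by \<open>2 * \<i> * b\<close> up to sign, with
      \<open>b = (1 - x) / (sqrt 2 * rt x)\<close> nonzero.\<close>
    using x rt[of x] by (auto simp: mu_eq)
  show "{c. is_eigenvalue (Rhat_x rt x) c} = {mu1 rt x, mu2 rt x}"
    by (rule eigenvalues_Rhat_x[of rt x, OF rt x])
  show "Pi1 rt x ** Pi1 rt x = Pi1 rt x" "Pi2 rt x ** Pi2 rt x = Pi2 rt x"
    unfolding pr by (rule half_proj_idem[OF Jmat_square], simp)+
  show "Pi1 rt x + Pi2 rt x = mat 1"
    unfolding pr using half_proj_sum[of Jmat "- \<i>"] by simp
  show "range (\<lambda>v. Pi1 rt x *v v) = eigenspace (Rhat_x rt x) (mu1 rt x)"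
    "range (\<lambda>v. Pi2 rt x *v v) = eigenspace (Rhat_x rt x) (mu2 rt x)"
    unfolding pr sp by (rule half_proj_range[OF Jmat_square], simp)+
  show "(Pi1 rt x *v v = 0) = (v \<in> eigenspace (Rhat_x rt x) (mu2 rt x))"
    "(Pi2 rt x *v v = 0) = (v \<in> eigenspace (Rhat_x rt x) (mu1 rt x))" for v
    \<comment> \<open>The kernel lemma negates \<open>e\<close>, so the kernel of each projector is
      the eigenspace of the other eigenvalue.\<close>
    unfolding pr sp using half_proj_kernel[OF Jmat_square i(1)] half_proj_kernel[OF Jmat_square i(2)]
    by simp_all
  show "commutator (Pi1 rt x) (\<Sum>k\<in>UNIV. kron (pi_fund (L s i k)) (pi_fund (L s k j))) = 0"
    "commutator (Pi2 rt x) (\<Sum>k\<in>UNIV. kron (pi_fund (L s i k)) (pi_fund (L s k j))) = 0" for s i j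
    unfolding pr half_proj_def pi_fund_L_gen by (intro commutator_affine Jmat_commute_gen)+
  show "commutator (Pi1 rt x) (pi_tensor_pi (coproduct a)) = 0"
    "commutator (Pi2 rt x) (pi_tensor_pi (coproduct a)) = 0" for a
    unfolding pr half_proj_def by (intro commutator_affine Jmat_commute)+
next
  fix x y assume x: "x \<notin> {0, 1 :: complex}" and y: "y \<notin> {0, 1 :: complex}"
  show "Pi1 rt x = Pi1 rt y" "Pi2 rt x = Pi2 rt y"
    by (simp_all only: Pi_eq[of rt x, OF rt x] Pi_eq[of rt y, OF rt y])
next
  fix c a v assume "v \<in> eigenspace Rhat c"
  then show "pi_tensor_pi (coproduct a) *v v \<in> eigenspace Rhat c"
    by (rule eigenspace_invariant[rotated]) (unfold Rhat_eq, intro commutator_affine Jmat_commute)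
qed

end
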